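(* Let $\mathcal{A}\in T(m,n)$ and $\mathbf{b}\in\mathbb{R}^n$, and for $\mathbf{x}\in\mathbb{R}^n$ define $$F(\mathbf{x})=(\mathcal{A}+\mathcal{I})\mathbf{x}^{m-1}-\mathbf{b},\qquad G(\mathbf{x})=(\mathcal{A}-\mathcal{I})\mathbf{x}^{m-1}-\mathbf{b}.$$ Then the tensor absolute value equation $\mathcal{A}\mathbf{x}^{m-1}-|\mathbf{x}|^{[m-1]}=\mathbf{b}$ is equivalent to the generalized tensor complementarity problem of finding $\mathbf{x}\in\mathbb{R}^n$ with $$F(\mathbf{x})\ge\mathbf{0},\quad G(\mathbf{x})\ge\mathbf{0},\quad F(\mathbf{x})^TG(\mathbf{x})=0,$$ and to the bi-multilinear program $$0=\min\{F(\mathbf{x})^TG(\mathbf{x}) : F(\mathbf{x})\ge\mathbf{0},\ G(\mathbf{x})\ge\mathbf{0}\};$$ that is, a vector $\mathbf{x}\in\mathbb{R}^n$ solves any one of these three problems if and only if it solves the other two.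
   Context: Throughout $m\ge 2$, and all tensors are real. $T(m,n)$ is the set of real $m$th-order $n$-dimensional tensors $\mathcal{A}=(a_{i_1i_2\ldots i_m})$, $1\le i_1,\ldots,i_m\le n$. For $\mathbf{x}\in\mathbb{R}^n$, $\mathcal{A}\mathbf{x}^{m-1}\in\mathbb{R}^n$ has components $(\mathcal{A}\mathbf{x}^{m-1})_i=\sum_{i_2,\ldots,i_m=1}^n a_{ii_2\ldots i_m}x_{i_2}\cdots x_{i_m}$, and $|\mathbf{x}|^{[m-1]}=(|x_1|^{m-1},\ldots,|x_n|^{m-1})^T$. $\mathcal{I}\in T(m,n)$ is the unit tensor, with entries $1$ if $i_1=\cdots=i_m$ and $0$ otherwise. Vector inequalities are componentwise. A solution of the bi-multilinear program is a feasible point $\mathbf{x}$ (i.e. $F(\mathbf{x})\ge\mathbf{0}$, $G(\mathbf{x})\ge\mathbf{0}$) at which the objective $F(\mathbf{x})^TG(\mathbf{x})$ attains the minimum value $0$. *)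

theory Defs
  imports "HOL-Analysis.Analysis" "HOL-Library.Function_Algebras"
begin

text \<open>
  The entry \<open>a\<^bsub>i\<^sub>1 i\<^sub>2 \<dots> i\<^sub>m\<^esub>\<close> of a tensor is its value at the
  list \<open>[i\<^sub>1, i\<^sub>2, \<dots>, i\<^sub>m]\<close>; indices range over a finite type \<open>'n\<close>, so that the
  dimension is \<open>CARD('n)\<close>.  Members of \<open>tensors m\<close> vanish on lists of any other length, so
  that they are determined by their entries.  Sums and differences of tensors are the
  pointwise ones from \<open>HOL-Library.Function_Algebras\<close>.
\<close>

type_synonym 'n tensor = "'n list \<Rightarrow> real"

definition tensors :: "nat \<Rightarrow> 'n tensor set" where
  "tensors m = {A. \<forall>is. length is \<noteq> m \<longrightarrow> A is = 0}"

definition unit_tensor :: "nat \<Rightarrow> 'n tensor" where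
  "unit_tensor m = (\<lambda>is. if \<exists>i. is = replicate m i then 1 else 0)"

text \<open>
  \<open>tensor_apply m A x\<close> is \<open>A x\<^bsup>m-1\<^esup>\<close>; the list \<open>js\<close> is \<open>[i\<^sub>2, \<dots>, i\<^sub>m]\<close>.
\<close>

definition tensor_apply :: "nat \<Rightarrow> 'n::finite tensor \<Rightarrow> real ^ 'n \<Rightarrow> real ^ 'n" where
  "tensor_apply m A x =
     (\<chi> i. \<Sum>js | length js = m - 1. A (i # js) * (\<Prod>j\<leftarrow>js. x $ j))"

definition abs_vec_pow :: "real ^ 'n \<Rightarrow> nat \<Rightarrow> real ^ 'n" where
  "abs_vec_pow x k = (\<chi> i. \<bar>x $ i\<bar> ^ k)"

definition solves_TAVE :: "nat \<Rightarrow> 'n::finite tensor \<Rightarrow> real ^ 'n \<Rightarrow> real ^ 'n \<Rightarrow> bool" where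
  "solves_TAVE m A b x \<longleftrightarrow> tensor_apply m A x - abs_vec_pow x (m - 1) = b"

text \<open>
  The order on \<open>real ^ 'n\<close> is the componentwise one.
\<close>

definition solves_GTCP ::
  "(real ^ 'n::finite \<Rightarrow> real ^ 'n) \<Rightarrow> (real ^ 'n \<Rightarrow> real ^ 'n) \<Rightarrow> real ^ 'n \<Rightarrow> bool" where
  "solves_GTCP F G x \<longleftrightarrow> F x \<ge> 0 \<and> G x \<ge> 0 \<and> F x \<bullet> G x = 0"

text \<open>
  A solution of the program is a feasible minimizer whose objective value is \<open>0\<close>;
  feasibility is part of \<^const>\<open>is_arg_min\<close>.
\<close>

definition solves_BMP ::
  "(real ^ 'n::finite \<Rightarrow> real ^ 'n) \<Rightarrow> (real ^ 'n \<Rightarrow> real ^ 'n) \<Rightarrow> real ^ 'n \<Rightarrow> bool" where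
  "solves_BMP F G x \<longleftrightarrow>
     is_arg_min (\<lambda>z. F z \<bullet> G z) (\<lambda>z. F z \<ge> 0 \<and> G z \<ge> 0) x \<and> F x \<bullet> G x = 0"

end

theory Submission
  imports Defs
begin

text \<open>
  The unit tensor acts as the componentwise power
  \<open>x \<mapsto> x\<^bsup>[m-1]\<^esup>\<close> (lemma \<open>tensor_apply_unit\<close>). With
  \<open>w = A x\<^bsup>m-1\<^esup> - b\<close> and \<open>t = x\<^bsup>[m-1]\<^esup>\<close>, linearity in the tensor therefore gives
  \<open>F x = w + t\<close> and \<open>G x = w - t\<close>. A sum of nonnegative products vanishes only if each product
  does, so the complementarity problem decouples into the scalar conditions \<open>w\<^sub>i + t\<^sub>i \<ge> 0\<close>,
  \<open>w\<^sub>i - t\<^sub>i \<ge> 0\<close>, \<open>(w\<^sub>i + t\<^sub>i) (w\<^sub>i - t\<^sub>i) = 0\<close>. The first two say \<open>w\<^sub>i \<ge> \<bar>t\<^sub>i\<bar>\<close> and the third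
  says \<open>\<bar>w\<^sub>i\<bar> = \<bar>t\<^sub>i\<bar>\<close>; together they are the absolute value equation \<open>w\<^sub>i = \<bar>t\<^sub>i\<bar>\<close>.
  The program agrees with the complementarity problem because its objective is nonnegative
  on the feasible set: a feasible point of value \<open>0\<close> is automatically a minimizer.
\<close>

lemma tensor_apply_add: "tensor_apply m (A + B) x = tensor_apply m A x + tensor_apply m B x"
  by (simp add: tensor_apply_def vec_eq_iff plus_fun_def distrib_right sum.distrib)

lemma tensor_apply_diff: "tensor_apply m (A - B) x = tensor_apply m A x - tensor_apply m B x"
  by (simp add: tensor_apply_def vec_eq_iff fun_diff_def left_diff_distrib sum_subtractf)

text \<open>
  In row \<open>i\<close> of the unit tensor the only nonzero entry is the diagonal one, whose remaining
  indices all equal \<open>i\<close>. There must be a first index to fix the row, so the order is at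
  least \<open>1\<close>.
\<close>

lemma tensor_apply_unit:
  assumes "m \<ge> 1"
  shows "tensor_apply m (unit_tensor m) x = (\<chi> i. (x $ i) ^ (m - 1))"
proof -
  have "(\<Sum>js | length js = m - 1. unit_tensor m (i # js) * (\<Prod>j\<leftarrow>js. x $ j)) = (x $ i) ^ (m - 1)"
    for i
  proof -
    have entry: "unit_tensor m (i # js) = (if js = replicate (m - 1) i then 1 else 0)" for js
      using assms by (cases m) (auto simp: unit_tensor_def)
    have fin: "finite {js :: 'a list. length js = m - 1}"
      using finite_lists_length_eq[of "UNIV :: 'a set" "m - 1"] by simp
    have "(\<Sum>js | length js = m - 1. unit_tensor m (i # js) * (\<Prod>j\<leftarrow>js. x $ j))
        = (\<Sum>js | length js = m - 1.
            if js = replicate (m - 1) i then (\<Prod>j\<leftarrow>js. x $ j) else 0)"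
      by (intro sum.cong) (auto simp: entry)
    also have "\<dots> = (\<Prod>j\<leftarrow>replicate (m - 1) i. x $ j)"
      using fin by (subst sum.delta) auto
    also have "\<dots> = (x $ i) ^ (m - 1)"
      by (simp add: prod_list_replicate)
    finally show ?thesis .
  qed
  then show ?thesis by (simp add: tensor_apply_def)
qed

lemma inner_vec_nonneg:
  fixes u v :: "real ^ 'n::finite"
  assumes "u \<ge> 0" "v \<ge> 0"
  shows "u \<bullet> v \<ge> 0"
  using assms by (auto simp: inner_vec_def less_eq_vec_def intro!: sum_nonneg mult_nonneg_nonneg)

text \<open>No cancellation can occur in a sum of nonnegative products.\<close>

lemma complementarity_componentwise:
  fixes u v :: "real ^ 'n::finite"
  shows "u \<ge> 0 \<and> v \<ge> 0 \<and> u \<bullet> v = 0 \<longleftrightarrow> (\<forall>i. u $ i \<ge> 0 \<and> v $ i \<ge> 0 \<and> u $ i * v $ i = 0)"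
proof (cases "u \<ge> 0 \<and> v \<ge> 0")
  case True
  then have "u $ i * v $ i \<ge> 0" for i
    by (simp add: less_eq_vec_def)
  then have "u \<bullet> v = 0 \<longleftrightarrow> (\<forall>i. u $ i * v $ i = 0)"
    unfolding inner_vec_def by (simp add: sum_nonneg_eq_0_iff)
  with True show ?thesis by (auto simp: less_eq_vec_def)
qed (auto simp: less_eq_vec_def)

lemma eq_abs_iff_complementary:
  fixes w t :: real
  shows "w = \<bar>t\<bar> \<longleftrightarrow> w + t \<ge> 0 \<and> w - t \<ge> 0 \<and> (w + t) * (w - t) = 0"
  by (auto simp: abs_if)

text \<open>
  The objective is nonnegative on the feasible set, so a feasible point of value \<open>0\<close> cannot be
  beaten by another one.
\<close>

lemma solves_BMP_iff_solves_GTCP: "solves_BMP F G x \<longleftrightarrow> solves_GTCP F G x"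
  using inner_vec_nonneg
  by (auto simp: solves_BMP_def solves_GTCP_def is_arg_min_def not_less)

theorem theorem4p2:
  fixes m :: nat and A :: "'n::finite tensor" and b :: "real ^ 'n"
    and F G :: "real ^ 'n \<Rightarrow> real ^ 'n" and x :: "real ^ 'n"
  assumes "m \<ge> 2"
    and "A \<in> tensors m"
    and "F = (\<lambda>z. tensor_apply m (A + unit_tensor m) z - b)"
    and "G = (\<lambda>z. tensor_apply m (A - unit_tensor m) z - b)"
  shows "(solves_TAVE m A b x \<longleftrightarrow> solves_GTCP F G x)
       \<and> (solves_GTCP F G x \<longleftrightarrow> solves_BMP F G x)
       \<and> (solves_TAVE m A b x \<longleftrightarrow> solves_BMP F G x)"
proof -
  define w where "w = tensor_apply m A x - b"
  define t where "t = (\<chi> i. (x $ i) ^ (m - 1))"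
  have F: "F x = w + t" and G: "G x = w - t"
    using assms
    by (simp_all add: w_def t_def tensor_apply_add tensor_apply_diff tensor_apply_unit)
  have "solves_TAVE m A b x \<longleftrightarrow> (\<forall>i. w $ i = \<bar>t $ i\<bar>)"
    by (auto simp: solves_TAVE_def abs_vec_pow_def w_def t_def vec_eq_iff power_abs algebra_simps)
  also have "\<dots> \<longleftrightarrow> solves_GTCP F G x"
    unfolding solves_GTCP_def complementarity_componentwise F G
    by (simp add: eq_abs_iff_complementary)
  finally show ?thesis
    by (simp add: solves_BMP_iff_solves_GTCP)
qed

end
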